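(* For any $k\ge 3$ and any $\epsilon>0$, there exist a constant $c>0$ and a distribution of instances of $k$-XOS maximization such that any randomized $(k-1-\epsilon)$-approximation algorithm calls the value oracle at least $\delta\cdot 2^{\Omega(n^c)}$ times with probability at least $1-\delta$ for any $0<\delta<1$.
   Context: A set function $f\colon 2^V\to\mathbb{R}$ on a finite set $V$ is additive if $f(X)=\sum_{v\in X}f(\{v\})$ for all $X\subseteq V$. For a positive integer $k$, it is $k$-XOS if there are additive functions $f_1,\dots,f_k\colon 2^V\to\mathbb{R}$ (values may be negative) such that $f(X)=\max_{1\le i\le k}f_i(X)$ for all $X\subseteq V$. $k$-XOS maximization: given a $k$-XOS function $f$ on $V$, with $n=|V|$, accessible only through a value oracle (a query $X\subseteq V$ returns $f(X)$), find $X\subseteq V$ maximizing $f(X)$. Here $k$ is a fixed constant. For $\alpha\ge 1$, a randomized algorithm is an $\alpha$-approximation algorithm if the expected function value of its output is at least $\frac{1}{\alpha}\cdot\max_{X\subseteq V}f(X)$.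
   Formalization: The number of oracle calls is read as its expectation over the algorithm's coins, with probability 1-δ over the instance only; jointly over coins the claim fails, since brute force with probability 1/α and otherwise outputting ∅ is an α-approximation. *)

theory Defs
  imports "HOL-Probability.Probability"
begin

definition additive_on :: "'v set \<Rightarrow> ('v set \<Rightarrow> real) \<Rightarrow> bool" where
  "additive_on V f \<longleftrightarrow> (\<forall>X. X \<subseteq> V \<longrightarrow> f X = (\<Sum>v\<in>X. f {v}))"

definition k_XOS :: "nat \<Rightarrow> 'v set \<Rightarrow> ('v set \<Rightarrow> real) \<Rightarrow> bool" where
  "k_XOS k V f \<longleftrightarrow> finite V \<and> k \<ge> 1 \<and>
     (\<exists>F :: nat \<Rightarrow> 'v set \<Rightarrow> real.
        (\<forall>i\<in>{1..k}. additive_on V (F i)) \<and>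
        (\<forall>X. X \<subseteq> V \<longrightarrow> f X = Max ((\<lambda>i. F i X) ` {1..k})))"

text \<open>
  Deterministic oracle algorithms are decision trees: a node either stops with an output set, or
  queries a set and continues depending on the real number returned. No bound is placed on the
  computation between queries. Trees are well-founded, so every run halts; this is no loss, because
  on a finite ground set an algorithm can remember all answers and decide everything once every
  subset has been queried.
\<close>

datatype 'v oracle_alg =
    Output "'v set"
  | Query "'v set" "real \<Rightarrow> 'v oracle_alg"

primrec alg_on :: "'v set \<Rightarrow> 'v oracle_alg \<Rightarrow> bool" where
  "alg_on V (Output X) \<longleftrightarrow> X \<subseteq> V"
| "alg_on V (Query X g) \<longleftrightarrow> X \<subseteq> V \<and> (\<forall>y. alg_on V (g y))"

primrec alg_output :: "('v set \<Rightarrow> real) \<Rightarrow> 'v oracle_alg \<Rightarrow> 'v set" where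
  "alg_output f (Output X) = X"
| "alg_output f (Query X g) = alg_output f (g (f X))"

primrec calls :: "('v set \<Rightarrow> real) \<Rightarrow> 'v oracle_alg \<Rightarrow> nat" where
  "calls f (Output X) = 0"
| "calls f (Query X g) = Suc (calls f (g (f X)))"

text \<open>
  A randomized algorithm is a probability distribution over deterministic ones (its coins are fixed
  in advance). The sigma-algebra is arbitrary, as long as the output and the number of oracle calls
  are random variables for every oracle.
\<close>

definition randomized_alg :: "'v set \<Rightarrow> 'v oracle_alg measure \<Rightarrow> bool" where
  "randomized_alg V R \<longleftrightarrow> prob_space R \<and> (\<forall>a\<in>space R. alg_on V a) \<and>
     (\<forall>f. alg_output f \<in> R \<rightarrow>\<^sub>M count_space UNIV \<and> calls f \<in> R \<rightarrow>\<^sub>M count_space UNIV)"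

definition expected_value :: "'v oracle_alg measure \<Rightarrow> ('v set \<Rightarrow> real) \<Rightarrow> real" where
  "expected_value R f = (\<integral>a. f (alg_output f a) \<partial>R)"

text \<open>
  The query complexity of a randomized algorithm on an instance \<open>f\<close> is its expected number of calls
  over its own coins; a bound ``with probability \<open>1 - \<delta>\<close>'' then refers to the choice of \<open>f\<close>.
  Such a bound jointly over the instance and the coins is impossible for \<open>\<alpha> > 1\<close>: querying all
  subsets with probability \<open>1 / \<alpha>\<close> and otherwise returning the empty set without any query is an
  \<open>\<alpha>\<close>-approximation. For deterministic algorithms the two readings coincide.
\<close>

definition expected_calls :: "'v oracle_alg measure \<Rightarrow> ('v set \<Rightarrow> real) \<Rightarrow> ennreal" where
  "expected_calls R f = (\<integral>\<^sup>+a. of_nat (calls f a) \<partial>R)"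

text \<open>
  The guarantee is required on every instance. The condition \<open>\<alpha> \<ge> 1\<close> is part of the notion; without
  it, the inequality would be meaningless for \<open>\<alpha> \<le> 0\<close>.
\<close>

definition approx_alg :: "nat \<Rightarrow> real \<Rightarrow> 'v set \<Rightarrow> 'v oracle_alg measure \<Rightarrow> bool" where
  "approx_alg k \<alpha> V R \<longleftrightarrow> \<alpha> \<ge> 1 \<and> randomized_alg V R \<and>
     (\<forall>f. k_XOS k V f \<longrightarrow> expected_value R f \<ge> (1 / \<alpha>) * Max (f ` Pow V))"

end

theory Submission
  imports Defs "HOL-Real_Asymp.Real_Asymp"
begin

text \<open>
  Put \<open>K = k - 1\<close> and choose sets \<open>B\<^sub>i\<close> of size \<open>m\<^sup>i\<close>, \<open>1 \<le> i \<le> K\<close>, whose elements carry weight \<open>m\<^sup>-\<^sup>i\<close>,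
  so that every \<open>B\<^sub>i\<close> has total weight 1. The public mask \<open>g X = max\<^sub>i |X \<inter> B\<^sub>i| / m\<^sup>i\<close> never exceeds 1.
  A hidden additive function equals \<open>1 - 1/s\<close> times the sum of all \<open>K\<close> weights outside a secret light
  set \<open>U\<close> and is \<open>-K\<close> on the elements of \<open>U\<close>; its value on the complement of \<open>U\<close> is close to \<open>K\<close>.
  The instance is the maximum of the mask and the hidden function.

  On sets that meet \<open>U\<close> the hidden function is nonpositive. On sets with few elements the scales \<open>m\<^sup>-\<^sup>i\<close>
  are too far apart for several of them to matter, so the mask wins again. Hence a query deviates from
  the mask only if it is large and misses \<open>U\<close>. If \<open>U\<close> is the lightest class of a uniformly random
  \<open>s\<close>-colouring of the ground set, a fixed query does so with probability exponentially small in \<open>m\<close>.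
  As long as all answers agree with the mask, an algorithm follows the same path whatever \<open>U\<close> is;
  but an approximation ratio below \<open>K\<close> forces it to output a deviating set with constant
  probability.
\<close>

section \<open>Oracle algorithms facing functions that rarely differ from a known one\<close>

text \<open>Follow the single path on which every answer is given by \<open>g\<close>.
  \<open>S\<close> collects the first \<open>T\<close> queries on it and, if the path ends by then,
  the output set, whence \<open>Suc T\<close>. It does not depend on \<open>f\<close>: a function
  agreeing with \<open>g\<close> on \<open>S\<close> cannot leave the path within these
  queries.\<close>

lemma distinguishing_queries:
  "\<exists>S. finite S \<and> card S \<le> Suc T \<and> (alg_on V a \<longrightarrow> S \<subseteq> Pow V) \<and>
     (\<forall>f. calls f a \<le> T \<and> f (alg_output f a) \<noteq> g (alg_output f a) \<longrightarrow> (\<exists>X\<in>S. f X \<noteq> g X))"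
proof (induction a arbitrary: T)
  case (Output X)
  show ?case by (rule exI[of _ "{X}"]) auto
next
  case (Query X h)
  show ?case
  proof (cases T)
    case 0
    \<comment> \<open>A query node costs at least one call, so the bound on \<open>calls\<close>
      fails and the claim is vacuous.\<close>
    then show ?thesis by (intro exI[of _ "{}"]) auto
  next
    case (Suc T')
    obtain S where S: "finite S" "card S \<le> Suc T'" "alg_on V (h (g X)) \<longrightarrow> S \<subseteq> Pow V"
      "\<forall>f. calls f (h (g X)) \<le> T' \<and>
         f (alg_output f (h (g X))) \<noteq> g (alg_output f (h (g X))) \<longrightarrow> (\<exists>X\<in>S. f X \<noteq> g X)"
      using Query.IH[OF rangeI[of h "g X"], of T'] by (elim exE conjE) (rule that, simp_all)
    have "card (insert X S) \<le> Suc T"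
      using S(1,2) Suc by (simp add: card_insert_if)
    moreover have "\<exists>Y\<in>insert X S. f Y \<noteq> g Y"
      if "calls f (Query X h) \<le> T"
        "f (alg_output f (Query X h)) \<noteq> g (alg_output f (Query X h))" for f
    proof (cases "f X = g X")
      case True
      then show ?thesis using spec[OF S(4), of f] that Suc by auto
    qed auto
    ultimately show ?thesis
      using S(1,3) by (intro exI[of _ "insert X S"]) auto
  qed
qed

lemma calls_eq_0_cong: "calls f a = 0 \<longleftrightarrow> calls g a = 0"
  by (cases a) auto

text \<open>A union bound over the at most \<open>Suc T\<close> sets of
  \<open>distinguishing_queries\<close>, which are the same for every \<open>x\<close>.\<close>

lemma prob_detect_le:
  fixes P :: "'i pmf" and F :: "'i \<Rightarrow> 'v set \<Rightarrow> real"
  assumes rare: "\<And>X. X \<subseteq> V \<Longrightarrow> measure_pmf.prob P {x. F x X \<noteq> g X} \<le> p"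
    and "alg_on V a"
  shows "measure_pmf.prob P {x. calls (F x) a \<le> T \<and>
           F x (alg_output (F x) a) \<noteq> g (alg_output (F x) a)} \<le> real (Suc T) * p"
    (is "measure_pmf.prob P ?E \<le> _")
proof -
  obtain S where S: "finite S" "card S \<le> Suc T" "S \<subseteq> Pow V"
    "\<forall>f. calls f a \<le> T \<and> f (alg_output f a) \<noteq> g (alg_output f a) \<longrightarrow> (\<exists>X\<in>S. f X \<noteq> g X)"
    using distinguishing_queries[of T V a g] assms(2) by (elim exE conjE) (rule that, simp_all)
  have "0 \<le> p"
    using rare[of "{}"] by (meson empty_subsetI measure_nonneg order_trans)
  have "measure_pmf.prob P ?E \<le> measure_pmf.prob P (\<Union>X\<in>S. {x. F x X \<noteq> g X})"
    by (intro measure_pmf.finite_measure_mono) (use S(4) in fastforce, simp)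
  also have "\<dots> \<le> (\<Sum>X\<in>S. measure_pmf.prob P {x. F x X \<noteq> g X})"
    using S(1) by (intro measure_pmf.finite_measure_subadditive_finite) auto
  also have "\<dots> \<le> (\<Sum>X\<in>S. p)"
    using S(3) rare by (intro sum_mono) auto
  also have "\<dots> \<le> real (Suc T) * p"
    using S(2) \<open>0 \<le> p\<close> by (simp add: mult_right_mono del: of_nat_Suc)
  finally show ?thesis .
qed

text \<open>
  The probabilities over the instance and over the coins are exchanged by a finite sum, since the set
  of queries along the mask path need not be a random variable.
\<close>

lemma randomized_prob_detect_le:
  fixes P :: "'i pmf" and F :: "'i \<Rightarrow> 'v set \<Rightarrow> real"
  assumes fin: "finite (set_pmf P)"
    and R: "randomized_alg V R"
    and rare: "\<And>X. X \<subseteq> V \<Longrightarrow> measure_pmf.prob P {x. F x X \<noteq> g X} \<le> p"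
    and found: "\<And>x. x \<in> set_pmf P \<Longrightarrow>
      \<rho> \<le> measure R {a\<in>space R. F x (alg_output (F x) a) \<noteq> g (alg_output (F x) a)}"
    and fast: "\<And>x. x \<in> set_pmf P \<Longrightarrow> x \<in> C \<Longrightarrow> measure R {a\<in>space R. T < calls (F x) a} \<le> \<rho> / 2"
  shows "measure_pmf.prob P C * (\<rho> / 2) \<le> real (Suc T) * p"
proof -
  interpret prob_space R using R by (simp add: randomized_alg_def)
  have meas [measurable]: "alg_output f \<in> R \<rightarrow>\<^sub>M count_space UNIV" "calls f \<in> R \<rightarrow>\<^sub>M count_space UNIV" for f
    using R by (auto simp: randomized_alg_def)
  define Fd where "Fd x = {a\<in>space R. F x (alg_output (F x) a) \<noteq> g (alg_output (F x) a)}" for x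
  define L where "L x = {a\<in>space R. T < calls (F x) a}" for x
  define E where "E x = {a\<in>space R. calls (F x) a \<le> T \<and>
                   F x (alg_output (F x) a) \<noteq> g (alg_output (F x) a)}" for x
  have sets: "Fd x \<in> sets R" "L x \<in> sets R" "E x \<in> sets R" for x
    unfolding Fd_def L_def E_def by measurable
  \<comment> \<open>A deviating output has probability at least \<rho>, of which runs with more than
    \<open>T\<close> calls account for at most half.\<close>
  have half: "\<rho> / 2 \<le> prob (E x)" if "x \<in> set_pmf P" "x \<in> C" for x
  proof -
    have "prob (Fd x) \<le> prob (E x \<union> L x)"
      by (intro finite_measure_mono sets.Un sets) (auto simp: Fd_def E_def L_def)
    also have "\<dots> \<le> prob (E x) + prob (L x)"
      by (intro measure_Un_le sets)
    finally show ?thesis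
      using found[OF that(1)] fast[OF that] by (simp add: Fd_def L_def)
  qed
  have "measure_pmf.prob P C * (\<rho> / 2) = measure_pmf.prob P (C \<inter> set_pmf P) * (\<rho> / 2)"
    by (simp add: measure_Int_set_pmf)
  also have "\<dots> = (\<Sum>x\<in>C \<inter> set_pmf P. pmf P x * (\<rho> / 2))"
    using fin by (simp add: measure_measure_pmf_finite sum_distrib_right sum_divide_distrib)
  also have "\<dots> \<le> (\<Sum>x\<in>C \<inter> set_pmf P. pmf P x * prob (E x))"
    using half by (intro sum_mono mult_left_mono) auto
  also have "\<dots> \<le> (\<Sum>x\<in>set_pmf P. pmf P x * prob (E x))"
    using fin by (intro sum_mono2) auto
  also have "\<dots> = (\<Sum>x\<in>set_pmf P. \<integral>a. pmf P x * indicator (E x) a \<partial>R)"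
    using sets by simp
  also have "\<dots> = (\<integral>a. (\<Sum>x\<in>set_pmf P. pmf P x * indicator (E x) a) \<partial>R)"
    using sets by (subst Bochner_Integration.integral_sum) (auto simp: emeasure_eq_measure)
  also have "\<dots> \<le> (\<integral>a. real (Suc T) * p \<partial>R)"
  proof (intro integral_mono)
    fix a assume a: "a \<in> space R"
    have "(\<Sum>x\<in>set_pmf P. pmf P x * indicator (E x) a) = (\<Sum>x\<in>{x. a \<in> E x} \<inter> set_pmf P. pmf P x)"
      using fin by (intro sum.mono_neutral_cong_right) (auto simp: indicator_def)
    also have "\<dots> = measure_pmf.prob P {x. a \<in> E x}"
      using fin by (simp add: measure_measure_pmf_finite[symmetric] measure_Int_set_pmf)
    also have "\<dots> \<le> real (Suc T) * p"
      using prob_detect_le[OF rare, where a = a and T = T and V = V] R a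
      by (simp add: randomized_alg_def E_def)
    finally show "(\<Sum>x\<in>set_pmf P. pmf P x * indicator (E x) a) \<le> real (Suc T) * p" .
  qed (use sets in \<open>auto simp: emeasure_eq_measure\<close>)
  also have "\<dots> = real (Suc T) * p" by (simp add: prob_space)
  finally show ?thesis .
qed

text \<open>Markov's inequality. Calls are integers, so exceeding the rounded threshold
  \<open>T\<close> means at least \<open>Suc T\<close> calls, and \<open>Suc T\<close> is at least
  \<open>2 * Q / \<rho>\<close>.\<close>

lemma prob_calls_gt_le:
  fixes Q \<rho> :: real
  assumes R: "randomized_alg V R" and less: "expected_calls R f < ennreal Q" and "0 < \<rho>"
  shows "measure R {a\<in>space R. nat \<lfloor>2 * Q / \<rho>\<rfloor> < calls f a} \<le> \<rho> / 2"
proof -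
  interpret prob_space R using R by (simp add: randomized_alg_def)
  have meas [measurable]: "calls f \<in> R \<rightarrow>\<^sub>M count_space UNIV"
    using R by (auto simp: randomized_alg_def)
  define T where "T = nat \<lfloor>2 * Q / \<rho>\<rfloor>"
  define L where "L = {a\<in>space R. T < calls f a}"
  have L: "L \<in> sets R" unfolding L_def by measurable
  have "0 < Q" using less by (metis ennreal_neg not_less not_less_zero)
  have "ennreal (real (Suc T) * prob L) = of_nat (Suc T) * emeasure R L"
    by (simp add: emeasure_eq_measure ennreal_mult' ennreal_of_nat_eq_real_of_nat)
  also have "\<dots> = (\<integral>\<^sup>+a. of_nat (Suc T) * indicator L a \<partial>R)"
    using L by (simp add: nn_integral_cmult_indicator)
  also have "\<dots> \<le> expected_calls R f"
    unfolding expected_calls_def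
  proof (intro nn_integral_mono)
    fix a
    have "(of_nat (Suc T) :: ennreal) \<le> of_nat (calls f a)" if "a \<in> L"
      using that unfolding of_nat_le_iff L_def by simp
    then show "(of_nat (Suc T) :: ennreal) * indicator L a \<le> of_nat (calls f a)"
      by (auto simp: indicator_def)
  qed
  also note less
  finally have "real (Suc T) * prob L < Q"
    using \<open>0 < Q\<close> by (simp add: ennreal_less_iff del: of_nat_Suc)
  moreover have "2 * Q / \<rho> \<le> real (Suc T)"
    unfolding T_def by linarith
  then have "2 * Q / \<rho> * prob L \<le> real (Suc T) * prob L"
    by (intro mult_right_mono) auto
  ultimately have "2 * Q / \<rho> * prob L < Q" by linarith
  then show ?thesis
    using \<open>0 < Q\<close> \<open>0 < \<rho>\<close> by (simp add: T_def L_def field_simps)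
qed

text \<open>On each instance in \<open>C\<close>, probability \<rho>/2 of a deviating output remains
  within \<open>T\<close> calls. Such quick detections are rare on average over the instances, so
  \<open>C\<close> is improbable. The condition on \<open>N * p\<close> settles large
  \<open>Q\<close>, the condition \<open>p < \<rho> / 2\<close> small \<open>Q\<close>.\<close>

lemma prob_expected_calls_ge:
  fixes P :: "'i pmf" and F :: "'i \<Rightarrow> 'v set \<Rightarrow> real" and N \<delta> :: real
  assumes fin: "finite (set_pmf P)"
    and R: "randomized_alg V R"
    and rare: "\<And>X. X \<subseteq> V \<Longrightarrow> measure_pmf.prob P {x. F x X \<noteq> g X} \<le> p"
    and found: "\<And>x. x \<in> set_pmf P \<Longrightarrow>
      \<rho> \<le> measure R {a\<in>space R. F x (alg_output (F x) a) \<noteq> g (alg_output (F x) a)}"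
    and "0 < \<rho>" "p < \<rho> / 2" "8 * (N * p) \<le> \<rho>\<^sup>2" "0 < \<delta>"
  shows "1 - \<delta> \<le> measure_pmf.prob P {x. ennreal (\<delta> * N) \<le> expected_calls R (F x)}"
proof -
  define Q where "Q = \<delta> * N"
  define T where "T = nat \<lfloor>2 * Q / \<rho>\<rfloor>"
  define C where "C = {x. expected_calls R (F x) < ennreal Q}"
  have fast: "measure R {a\<in>space R. T < calls (F x) a} \<le> \<rho> / 2" if "x \<in> C" for x
    using prob_calls_gt_le[OF R _ \<open>0 < \<rho>\<close>] that by (auto simp: T_def C_def)
  have le: "measure_pmf.prob P C * (\<rho> / 2) \<le> real (Suc T) * p"
    by (rule randomized_prob_detect_le[OF fin R rare found]) (use fast in auto)
  have "0 \<le> p"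
    using rare[of "{}"] by (meson empty_subsetI measure_nonneg order_trans)
  have "measure_pmf.prob P C \<le> \<delta>"
  proof (cases "\<rho> / 2 \<le> Q")
    case True
    \<comment> \<open>The summand 1 is absorbed because \<open>2 * Q / \<rho>\<close> is at least 1
      in this case.\<close>
    have "real (Suc T) \<le> 2 * Q / \<rho> + 1"
      using True \<open>0 < \<rho>\<close> unfolding T_def by simp
    also have "\<dots> \<le> 4 * Q / \<rho>"
      using True \<open>0 < \<rho>\<close> by (simp add: field_simps)
    finally have "measure_pmf.prob P C * (\<rho> / 2) \<le> 4 * Q / \<rho> * p"
      using le mult_right_mono[OF _ \<open>0 \<le> p\<close>] by (meson order_trans)
    then have "measure_pmf.prob P C * \<rho>\<^sup>2 \<le> \<delta> * (8 * (N * p))"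
      using \<open>0 < \<rho>\<close> by (simp add: field_simps power2_eq_square Q_def)
    also have "\<dots> \<le> \<delta> * \<rho>\<^sup>2" using assms by (intro mult_left_mono) auto
    finally show ?thesis using \<open>0 < \<rho>\<close> by simp
  next
    case False
    \<comment> \<open>For small \<open>Q\<close> the summand 1 in \<open>Suc T\<close> dominates and
      the factor \<delta> would be lost; instead \<open>C\<close> is shown to be empty.\<close>
    then have "2 * Q / \<rho> < 1" using \<open>0 < \<rho>\<close> by (simp add: field_simps)
    then have "T = 0" unfolding T_def by linarith
    \<comment> \<open>Whether an algorithm stops without any call does not depend on the oracle.\<close>
    have "C = {}"
    proof (rule ccontr)
      assume "C \<noteq> {}"
      then obtain x where x: "x \<in> C" by auto
      have "{a\<in>space R. 0 < calls (F y) a} = {a\<in>space R. 0 < calls (F x) a}" for y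
        unfolding neq0_conv[symmetric] by (subst calls_eq_0_cong[where g = "F x"]) (rule refl)
      then have "measure R {a\<in>space R. 0 < calls (F y) a} \<le> \<rho> / 2" for y
        using fast[OF x] unfolding \<open>T = 0\<close> by metis
      \<comment> \<open>One instance in \<open>C\<close> makes all instances fast, so the averaging
        bound applies to \<open>UNIV\<close>, a set of probability 1.\<close>
      then have "measure_pmf.prob P UNIV * (\<rho> / 2) \<le> real (Suc 0) * p"
        by (intro randomized_prob_detect_le[OF fin R rare found]) auto
      then show False using \<open>p < \<rho> / 2\<close> by simp
    qed
    then show ?thesis using \<open>0 < \<delta>\<close> by simp
  qed
  moreover have "measure_pmf.prob P {x. ennreal Q \<le> expected_calls R (F x)} = 1 - measure_pmf.prob P C"
  proof -
    have "{x. ennreal Q \<le> expected_calls R (F x)} = space (measure_pmf P) - C"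
      by (auto simp: C_def not_less)
    then show ?thesis using measure_pmf.prob_compl[of C P] by simp
  qed
  ultimately show ?thesis by (simp add: Q_def)
qed

section \<open>The hard instances: a mask at geometric scales and a hidden additive function\<close>

lemma additive_on_sum: "additive_on V (\<lambda>X. \<Sum>v\<in>X. c v)"
  by (simp add: additive_on_def)

locale scales =
  fixes V :: "'v set" and B :: "nat \<Rightarrow> 'v set" and K m s :: nat
  assumes finite_V: "finite V" and K_pos: "0 < K" and m_pos: "0 < m" and s_ge_2: "2 \<le> s"
    and B_subset: "\<And>i. i < K \<Longrightarrow> B i \<subseteq> V"
    and card_B: "\<And>i. i < K \<Longrightarrow> card (B i) = m ^ Suc i"
begin

text \<open>
  The indices are shifted by one against the header, and the \<open>B i\<close> may overlap (they will be nested
  initial segments).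
\<close>

definition part :: "nat \<Rightarrow> 'v set \<Rightarrow> real" where
  "part i X = (\<Sum>v\<in>X. indicator (B i) v / real m ^ Suc i)"

definition total :: "'v set \<Rightarrow> real" where
  "total X = (\<Sum>i<K. part i X)"

definition mask :: "'v set \<Rightarrow> real" where
  "mask X = Max ((\<lambda>i. part i X) ` {..<K})"

text \<open>The penalty \<open>K\<close> equals \<open>total V\<close>, so a single element of
  \<open>U\<close> cancels every possible gain. The factor \<open>1 - 1 / s\<close> is the slack
  that lets the mask win on small sets.\<close>

definition hidden :: "'v set \<Rightarrow> 'v set \<Rightarrow> real" where
  "hidden U X = (\<Sum>v\<in>X. if v \<in> U then - real K else (1 - 1 / s) * total {v})"

definition inst :: "'v set \<Rightarrow> 'v set \<Rightarrow> real" where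
  "inst U X = max (mask X) (hidden U X)"

lemma part_eq: "finite X \<Longrightarrow> part i X = card (X \<inter> B i) / real m ^ Suc i"
  unfolding part_def by (simp add: sum_divide_distrib[symmetric] indicator_def sum.If_cases Collect_mem_eq)

lemma part_V: "i < K \<Longrightarrow> part i V = 1"
  using finite_V m_pos B_subset card_B by (simp add: part_eq Int_absorb1)

lemma part_nonneg: "0 \<le> part i X"
  unfolding part_def by (intro sum_nonneg) (auto simp: indicator_def)

lemma part_mono: "X \<subseteq> Y \<Longrightarrow> Y \<subseteq> V \<Longrightarrow> part i X \<le> part i Y"
  unfolding part_def using finite_V by (intro sum_mono2) (auto intro: finite_subset)

lemma total_eq: "total X = (\<Sum>v\<in>X. total {v})"
  unfolding total_def part_def by (subst sum.swap) simp

lemma total_nonneg: "0 \<le> total X"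
  unfolding total_def by (intro sum_nonneg part_nonneg)

lemma total_V: "total V = K"
  unfolding total_def using part_V by simp

lemma total_mono: "X \<subseteq> Y \<Longrightarrow> Y \<subseteq> V \<Longrightarrow> total X \<le> total Y"
  unfolding total_def by (intro sum_mono part_mono)

lemma part_le_mask: "i < K \<Longrightarrow> part i X \<le> mask X"
  unfolding mask_def by (intro Max_ge) auto

lemma mask_nonneg: "0 \<le> mask X"
  using part_le_mask[OF K_pos, of X] part_nonneg[of 0 X] by linarith

lemma mask_le_1:
  assumes "X \<subseteq> V"
  shows "mask X \<le> 1"
proof -
  have "part i X \<le> 1" if "i < K" for i
    using part_mono[OF assms order_refl, of i] part_V[OF that] by simp
  then show ?thesis
    unfolding mask_def using K_pos by (subst Max_le_iff) (auto simp: lessThan_empty_iff)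
qed

lemma hidden_disjoint: "X \<inter> U = {} \<Longrightarrow> hidden U X = (1 - 1 / s) * total X"
  by (subst total_eq) (auto simp: hidden_def sum_distrib_left intro!: sum.cong)

lemma hidden_nonpos:
  assumes "X \<subseteq> V" "X \<inter> U \<noteq> {}"
  shows "hidden U X \<le> 0"
proof -
  have fin: "finite X" using assms finite_V by (auto intro: finite_subset)
  obtain u where u: "u \<in> X" "u \<in> U" using assms by auto
  have nn: "0 \<le> 1 - 1 / real s" "1 - 1 / real s \<le> 1" using s_ge_2 by auto
  have "hidden U X = - real K + (\<Sum>v\<in>X - {u}. if v \<in> U then - real K else (1 - 1 / s) * total {v})"
    unfolding hidden_def using fin u by (subst sum.remove[of _ u]) auto
  also have "(\<Sum>v\<in>X - {u}. if v \<in> U then - real K else (1 - 1 / s) * total {v}) \<le> (\<Sum>v\<in>X - {u}. total {v})"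
    using nn total_nonneg by (intro sum_mono) (auto intro: mult_left_le_one_le order_trans[of _ 0])
  also have "\<dots> = total (X - {u})" by (rule total_eq[symmetric])
  also have "\<dots> \<le> real K"
    using total_mono[of "X - {u}" V] total_V assms by auto
  finally show ?thesis by simp
qed

lemma hidden_le:
  assumes "X \<subseteq> V"
  shows "hidden U X \<le> K"
proof (cases "X \<inter> U = {}")
  case True
  have "(1 - 1 / s) * total X \<le> 1 * total V"
    using s_ge_2 assms by (intro mult_mono total_mono total_nonneg) auto
  then show ?thesis using hidden_disjoint[OF True] total_V by simp
next
  case False
  then show ?thesis using hidden_nonpos[OF assms False] by simp
qed

lemma inst_le: "X \<subseteq> V \<Longrightarrow> inst U X \<le> K"
  unfolding inst_def using mask_le_1[of X] hidden_le[of X U] K_pos by auto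

lemma inst_nonneg: "0 \<le> inst U X"
  unfolding inst_def using mask_nonneg[of X] by auto

lemma k_XOS_inst: "k_XOS (Suc K) V (inst U)"
proof -
  \<comment> \<open>\<open>k_XOS\<close> counts from 1 and \<open>part\<close> from 0; the hidden
    function takes the last place.\<close>
  define F where "F i = (if i = Suc K then hidden U else part (i - 1))" for i
  have "additive_on V (F i)" for i
    unfolding F_def hidden_def part_def using additive_on_sum by auto
  moreover have "inst U X = Max ((\<lambda>i. F i X) ` {1..Suc K})" for X
  proof -
    have "(\<lambda>i. F i X) ` {1..Suc K} = (\<lambda>i. F (Suc i) X) ` {..K}"
      by (subst image_Suc_atMost[of K, symmetric]) (simp only: image_image)
    also have "\<dots> = insert (hidden U X) ((\<lambda>i. part i X) ` {..<K})"
      unfolding F_def lessThan_Suc_atMost[symmetric] lessThan_Suc by auto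
    finally show ?thesis
      using K_pos by (simp add: inst_def mask_def max.commute lessThan_empty_iff)
  qed
  ultimately show ?thesis
    unfolding k_XOS_def using finite_V by (intro conjI exI[of _ F]) auto
qed

text \<open>
  On a small set, one element at the lowest occurring scale outweighs everything at later scales.
\<close>

lemma total_le_mask:
  assumes "X \<subseteq> V" "s * K * card X \<le> m"
  shows "(1 - 1 / s) * total X \<le> mask X"
proof (cases "\<exists>i<K. X \<inter> B i \<noteq> {}")
  case False
  then have "total X = 0"
    unfolding total_def part_def by (auto simp: indicator_def disjoint_iff intro!: sum.neutral)
  then show ?thesis using mask_nonneg by simp
next
  case True
  have fin: "finite X" using assms(1) finite_V by (rule finite_subset)
  have m: "0 < real m" and s: "0 < real s" using m_pos s_ge_2 by auto
  define j where "j = (LEAST i. i < K \<and> X \<inter> B i \<noteq> {})"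
  have j: "j < K" "X \<inter> B j \<noteq> {}"
    using LeastI_ex[OF True] by (auto simp: j_def)
  have before: "part i X = 0" if "i < j" for i
    using not_less_Least[OF that[unfolded j_def]] that j(1) fin by (simp add: part_eq)
  define pj where "pj = part j X"
  have pj: "1 / real m ^ Suc j \<le> pj"
  proof -
    have "1 \<le> card (X \<inter> B j)" using j(2) fin by (simp add: Suc_le_eq card_gt_0_iff)
    then show ?thesis unfolding pj_def part_eq[OF fin] using m by (intro divide_right_mono) auto
  qed
  \<comment> \<open>Each later scale loses a factor of at least \<open>m\<close>, while
    \<open>X\<close> has at most \<open>m / (s * K)\<close> elements to make up for it.\<close>
  have small: "part i X \<le> pj / (real s * real K)" if "j < i" for i
  proof -
    have "part i X \<le> real (card X) / real m ^ Suc i"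
      unfolding part_eq[OF fin] using m fin by (intro divide_right_mono) (auto intro: card_mono)
    also have "\<dots> \<le> real (card X) / real m ^ Suc (Suc j)"
      using that m_pos by (intro divide_left_mono power_increasing mult_pos_pos zero_less_power) auto
    also have "\<dots> = (real (card X) / m) * (1 / real m ^ Suc j)" by simp
    also have "\<dots> \<le> (1 / (real s * real K)) * pj"
    proof (intro mult_mono pj)
      have "real s * real K * real (card X) \<le> real m"
        using assms(2) by (metis of_nat_mult of_nat_le_iff)
      then show "real (card X) / m \<le> 1 / (real s * real K)"
        using m s K_pos by (simp add: field_simps)
    qed auto
    finally show ?thesis by simp
  qed
  have "total X = pj + (\<Sum>i\<in>{..<K} - {j}. part i X)"
    unfolding total_def pj_def using j by (subst sum.remove[of _ j]) auto
  also have "(\<Sum>i\<in>{..<K} - {j}. part i X) \<le> (\<Sum>i\<in>{..<K} - {j}. pj / (real s * real K))"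
  proof (intro sum_mono)
    fix i assume "i \<in> {..<K} - {j}"
    then consider "i < j" | "j < i" by fastforce
    then show "part i X \<le> pj / (real s * real K)"
      using before small part_nonneg[of j X] by cases (auto simp: pj_def)
  qed
  also have "\<dots> \<le> (\<Sum>i<K. pj / (real s * real K))"
    using part_nonneg[of j X] by (intro sum_mono2) (auto simp: pj_def)
  also have "\<dots> = pj / s" using K_pos by simp
  \<comment> \<open>This is where the slack in \<open>hidden\<close> is spent: (1 - 1/s)(1 + 1/s) is
    at most 1.\<close>
  finally have "(1 - 1 / s) * total X \<le> (1 - 1 / s) * (pj + pj / s)"
    using s_ge_2 by (intro mult_left_mono) auto
  also have "\<dots> = pj - pj / (real s)\<^sup>2"
    using s by (simp add: field_simps power2_eq_square)
  also have "\<dots> \<le> pj" using part_nonneg[of j X] by (simp add: pj_def)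
  also have "\<dots> \<le> mask X" unfolding pj_def by (rule part_le_mask[OF j(1)])
  finally show ?thesis .
qed

lemma inst_eq_mask:
  assumes "X \<subseteq> V" "X \<inter> U \<noteq> {} \<or> s * K * card X \<le> m"
  shows "inst U X = mask X"
proof (cases "X \<inter> U = {}")
  case True
  then show ?thesis
    using total_le_mask[of X] assms by (simp add: inst_def hidden_disjoint)
next
  case False
  then show ?thesis
    using hidden_nonpos[OF assms(1) False] mask_nonneg[of X] by (simp add: inst_def)
qed

section \<open>Random colourings and the light class\<close>

definition colour_class :: "('v \<Rightarrow> nat) \<Rightarrow> nat \<Rightarrow> 'v set" where
  "colour_class \<phi> r = {v\<in>V. \<phi> v = r}"

text \<open>Choosing a class of small weight keeps the optimum near \<open>K\<close>. The chosen
  colour depends on the whole colouring, so probabilities have to be bounded for all colours at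
  once.\<close>

definition light :: "('v \<Rightarrow> nat) \<Rightarrow> 'v set" where
  "light \<phi> = colour_class \<phi> (SOME r. r < s \<and> total (colour_class \<phi> r) \<le> K / s)"

text \<open>Averaging: the \<open>s\<close> classes partition \<open>V\<close>, whose total weight
  is \<open>K\<close>.\<close>

lemma light:
  assumes "\<phi> \<in> V \<rightarrow>\<^sub>E {..<s}"
  shows "\<exists>r<s. light \<phi> = colour_class \<phi> r" "total (light \<phi>) \<le> K / s"
proof -
  have "\<exists>r. r < s \<and> total (colour_class \<phi> r) \<le> K / s"
  proof (rule ccontr)
    assume "\<not> ?thesis"
    then have "(\<Sum>r<s. K / real s) < (\<Sum>r<s. total (colour_class \<phi> r))"
      using s_ge_2 by (intro sum_strict_mono) (auto simp: not_le lessThan_empty_iff)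
    also have "\<dots> = (\<Sum>r<s. \<Sum>v\<in>colour_class \<phi> r. total {v})"
      by (subst total_eq) (rule refl)
    also have "\<dots> = (\<Sum>v\<in>V. total {v})"
      unfolding colour_class_def using assms finite_V by (intro sum.group) auto
    also have "\<dots> = K" using total_eq[of V] total_V by simp
    finally show False using s_ge_2 by simp
  qed
  from someI_ex[OF this]
  show "\<exists>r<s. light \<phi> = colour_class \<phi> r" "total (light \<phi>) \<le> K / s"
    unfolding light_def by auto
qed

lemma light_subset: "light \<phi> \<subseteq> V"
  by (auto simp: light_def colour_class_def)

text \<open>The witness is the complement of the light class. One factor \<open>1 - 1 / s\<close> is
  the weight lost with that class, the other is the scaling in \<open>hidden\<close>.\<close>

lemma Max_inst_ge:
  assumes "\<phi> \<in> V \<rightarrow>\<^sub>E {..<s}"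
  shows "(1 - 1 / s)\<^sup>2 * K \<le> Max (inst (light \<phi>) ` Pow V)"
proof -
  have "total V = total (V - light \<phi>) + total (light \<phi>)"
    using light_subset finite_V
    by (simp add: total_eq[of V] total_eq[of "V - _"] total_eq[of "light \<phi>"] sum.subset_diff)
  then have "(1 - 1 / s) * K \<le> total (V - light \<phi>)"
    using light(2)[OF assms] total_V by (simp add: left_diff_distrib)
  then have "(1 - 1 / s) * ((1 - 1 / s) * K) \<le> (1 - 1 / s) * total (V - light \<phi>)"
    using s_ge_2 by (intro mult_left_mono) auto
  also have "\<dots> \<le> inst (light \<phi>) (V - light \<phi>)"
    by (subst hidden_disjoint[of _ "light \<phi>", symmetric]) (auto simp: inst_def)
  also have "\<dots> \<le> Max (inst (light \<phi>) ` Pow V)"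
    using finite_V by (intro Max_ge) auto
  finally show ?thesis by (simp add: power2_eq_square mult.assoc)
qed

abbreviation colourings :: "('v \<Rightarrow> nat) pmf" where
  "colourings \<equiv> pmf_of_set (V \<rightarrow>\<^sub>E {..<s})"

lemma finite_colourings: "finite (V \<rightarrow>\<^sub>E {..<s})"
  using finite_V by (intro finite_PiE) auto

lemma colourings_nonempty: "V \<rightarrow>\<^sub>E {..<s} \<noteq> {}"
  using s_ge_2 by (auto simp: PiE_eq_empty_iff lessThan_empty_iff)

lemma set_colourings: "set_pmf colourings = V \<rightarrow>\<^sub>E {..<s}"
  using finite_colourings colourings_nonempty by simp

lemma prob_avoid:
  assumes "X \<subseteq> V" "r < s"
  shows "measure_pmf.prob colourings {\<phi>. X \<inter> colour_class \<phi> r = {}} = (1 - 1 / s) ^ card X"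
proof -
  \<comment> \<open>The event is itself a product set, so its probability factors over the elements;
    those outside \<open>X\<close> contribute 1.\<close>
  have "(V \<rightarrow>\<^sub>E {..<s}) \<inter> {\<phi>. X \<inter> colour_class \<phi> r = {}} =
        (\<Pi>\<^sub>E v\<in>V. if v \<in> X then {..<s} - {r} else {..<s})"
    using assms by (auto simp: colour_class_def PiE_iff split: if_splits)
  then have "card ((V \<rightarrow>\<^sub>E {..<s}) \<inter> {\<phi>. X \<inter> colour_class \<phi> r = {}}) =
        (\<Prod>v\<in>V. if v \<in> X then s - 1 else s)"
    using finite_V assms(2) by (simp add: card_PiE if_distrib[of card] cong: if_cong)
  moreover have "card (V \<rightarrow>\<^sub>E {..<s}) = (\<Prod>v\<in>V. s)"
    using finite_V by (simp add: card_PiE)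
  ultimately have "measure_pmf.prob colourings {\<phi>. X \<inter> colour_class \<phi> r = {}} =
      (\<Prod>v\<in>V. (if v \<in> X then real s - 1 else real s) / s)"
    using finite_colourings colourings_nonempty s_ge_2
    by (simp add: measure_pmf_of_set prod_dividef of_nat_prod if_distrib[of real] cong: if_cong)
  also have "\<dots> = (\<Prod>v\<in>V. if v \<in> X then 1 - 1 / real s else 1)"
    using s_ge_2 by (intro prod.cong) (auto simp: field_simps)
  also have "\<dots> = (1 - 1 / s) ^ card X"
    using finite_V assms(1) by (simp add: prod.If_cases Int_absorb1)
  finally show ?thesis .
qed

lemma prob_inst_neq_mask_le:
  assumes "X \<subseteq> V"
  shows "measure_pmf.prob colourings {\<phi>. inst (light \<phi>) X \<noteq> mask X} \<le>
         s * exp (- (m / (real s ^ 2 * K)))"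
proof (cases "s * K * card X \<le> m")
  case True
  then show ?thesis using inst_eq_mask[OF assms] by simp
next
  case False
  have s: "2 \<le> real s" using s_ge_2 by simp
  have "measure_pmf.prob colourings {\<phi>. inst (light \<phi>) X \<noteq> mask X} =
        measure_pmf.prob colourings ({\<phi>. inst (light \<phi>) X \<noteq> mask X} \<inter> set_pmf colourings)"
    by (simp add: measure_Int_set_pmf)
  \<comment> \<open>A deviating \<open>X\<close> misses the light class, hence misses some colour
    class; summing over all colours costs the factor \<open>s\<close>.\<close>
  also have "\<dots> \<le> measure_pmf.prob colourings (\<Union>r<s. {\<phi>. X \<inter> colour_class \<phi> r = {}})"
  proof (intro measure_pmf.finite_measure_mono subsetI)
    fix \<phi> assume "\<phi> \<in> {\<phi>. inst (light \<phi>) X \<noteq> mask X} \<inter> set_pmf colourings"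
    then have "X \<inter> light \<phi> = {}" "\<phi> \<in> V \<rightarrow>\<^sub>E {..<s}"
      using inst_eq_mask[OF assms, of "light \<phi>"] unfolding set_colourings by auto
    then show "\<phi> \<in> (\<Union>r<s. {\<phi>. X \<inter> colour_class \<phi> r = {}})"
      using light(1)[of \<phi>] by auto
  qed simp
  also have "\<dots> \<le> (\<Sum>r<s. measure_pmf.prob colourings {\<phi>. X \<inter> colour_class \<phi> r = {}})"
    by (intro measure_pmf.finite_measure_subadditive_finite) auto
  also have "\<dots> = s * (1 - 1 / s) ^ card X"
    using prob_avoid[OF assms] by simp
  also have "\<dots> \<le> s * exp (- (1 / s)) ^ card X"
    using s exp_ge_add_one_self[of "- (1 / real s)"] by (intro mult_left_mono power_mono) auto
  also have "\<dots> = s * exp (- (card X / s))"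
    by (simp add: exp_of_nat_mult[symmetric])
  also have "\<dots> \<le> s * exp (- (m / (real s ^ 2 * K)))"
  proof -
    have "real m \<le> real s * real K * real (card X)"
      using False by (metis nat_le_linear of_nat_le_iff of_nat_mult)
    then have "m / (real s ^ 2 * K) \<le> card X / s"
      using s K_pos by (simp add: field_simps power2_eq_square)
    then show ?thesis by (intro mult_left_mono) auto
  qed
  finally show ?thesis .
qed

text \<open>Outputs on which the instance equals the mask are worth at most 1, all others at most
  \<open>K\<close>. If a deviation has probability q, the expected value is thus at most 1 + K q,
  while the guarantee demands the optimum divided by \<alpha>.\<close>

lemma approx_alg_found:
  fixes \<alpha> \<rho> :: real
  assumes approx: "approx_alg (Suc K) \<alpha> V R" and "\<phi> \<in> V \<rightarrow>\<^sub>E {..<s}"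
    and \<rho>: "(1 + K * \<rho>) * \<alpha> \<le> (1 - 1 / s)\<^sup>2 * K"
  shows "\<rho> \<le> measure R {a\<in>space R. inst (light \<phi>) (alg_output (inst (light \<phi>)) a) \<noteq>
                                  mask (alg_output (inst (light \<phi>)) a)}"
proof -
  define f where "f = inst (light \<phi>)"
  have R: "randomized_alg V R" and \<alpha>: "1 \<le> \<alpha>"
    using approx by (auto simp: approx_alg_def)
  interpret prob_space R using R by (simp add: randomized_alg_def)
  have meas [measurable]: "alg_output f \<in> R \<rightarrow>\<^sub>M count_space UNIV"
    using R by (auto simp: randomized_alg_def)
  have out: "alg_output f a \<subseteq> V" if "a \<in> space R" for a
  proof -
    have "alg_on V a \<Longrightarrow> alg_output f a \<subseteq> V" by (induction a) auto
    then show ?thesis using R that by (auto simp: randomized_alg_def)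
  qed
  define E where "E = {a\<in>space R. f (alg_output f a) \<noteq> mask (alg_output f a)}"
  have E: "E \<in> events" unfolding E_def by measurable
  have "1 + K * \<rho> \<le> (1 - 1 / s)\<^sup>2 * K / \<alpha>"
    using \<rho> \<alpha> by (simp add: field_simps)
  also have "\<dots> \<le> Max (f ` Pow V) / \<alpha>"
    using Max_inst_ge[OF assms(2)] \<alpha> unfolding f_def by (intro divide_right_mono) auto
  also have "\<dots> \<le> (\<integral>a. f (alg_output f a) \<partial>R)"
    using approx k_XOS_inst[of "light \<phi>"] by (simp add: approx_alg_def expected_value_def f_def)
  also have "\<dots> \<le> (\<integral>a. 1 + real K * indicat_real E a \<partial>R)"
  proof (intro integral_mono)
    show "integrable R (\<lambda>a. f (alg_output f a))"
    proof (intro integrable_const_bound[of _ "real K"] AE_I2)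
      show "norm (f (alg_output f a)) \<le> real K" if "a \<in> space R" for a
        using inst_nonneg[of "light \<phi>"] inst_le[OF out[OF that]] by (simp add: f_def)
    qed (rule measurable_compose[OF meas], simp)
    show "integrable R (\<lambda>a. 1 + real K * indicat_real E a)"
      using E by (auto simp: emeasure_eq_measure)
    show "f (alg_output f a) \<le> 1 + real K * indicat_real E a" if "a \<in> space R" for a
      using inst_le[OF out[OF that], of "light \<phi>"] mask_le_1[OF out[OF that]] that
      by (auto simp: E_def f_def indicator_def)
  qed
  also have "\<dots> = 1 + K * prob E"
    using E by (simp add: prob_space emeasure_eq_measure)
  finally show ?thesis using K_pos by (simp add: E_def f_def)
qed

end

section \<open>Choice of parameters and asymptotics\<close>

theorem theorem5:
  fixes k :: nat and \<epsilon> :: real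
  assumes "k \<ge> 3" and "\<epsilon> > 0"
  shows "\<exists>(c::real) > 0. \<exists>D :: nat \<Rightarrow> (nat set \<Rightarrow> real) pmf.
    (\<forall>n. \<forall>f\<in>set_pmf (D n). k_XOS k {..<n} f) \<and>
    (\<exists>\<gamma>>0. \<forall>\<^sub>F n in sequentially.
       \<forall>R. approx_alg k (real k - 1 - \<epsilon>) {..<n} R \<longrightarrow>
         (\<forall>\<delta>. 0 < \<delta> \<and> \<delta> < 1 \<longrightarrow>
            measure_pmf.prob (D n)
              {f. expected_calls R f \<ge> ennreal (\<delta> * 2 powr (\<gamma> * real n powr c))} \<ge> 1 - \<delta>))"
proof -
  define K where "K = k - 1"
  have k: "k = Suc K" and K: "0 < K" using assms(1) by (auto simp: K_def)
  \<comment> \<open>Chosen so that \<open>2 * K / s\<close>, which bounds the loss in the optimum,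
    is at most \<epsilon>/2.\<close>
  define s where "s = max 2 (nat \<lceil>4 * K / \<epsilon>\<rceil>)"
  have s: "2 \<le> s" "4 * K / \<epsilon> \<le> s" unfolding s_def by linarith+
  \<comment> \<open>Chosen so that \<open>K * \<rho> * K\<close> is \<epsilon>/2, the other half of
    the gap.\<close>
  define \<rho> where "\<rho> = \<epsilon> / (2 * real K ^ 2)"
  have \<rho>: "0 < \<rho>" using assms(2) K by (simp add: \<rho>_def)
  \<comment> \<open>The largest block has \<open>m n ^ K\<close> elements and must fit into
    \<open>n\<close>.\<close>
  define c where "c = 1 / real K"
  have c: "0 < c" using K by (simp add: c_def)
  define a where "a = 1 / (real s ^ 2 * K)"
  have a: "0 < a" using K s(1) by (simp add: a_def)
  define m where "m n = nat \<lfloor>real n powr c\<rfloor>" for n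
  define B where "B n i = {..<m n ^ Suc i}" for n i :: nat
  \<comment> \<open>Only half of the decay rate \<open>a\<close> of \<open>p\<close> is used, so
    that \<open>N n * p n\<close> still tends to 0.\<close>
  define N where "N n = 2 powr (a / 2 * real n powr c)" for n :: nat
  define p where "p n = s * exp (- (m n / (real s ^ 2 * K)))" for n

  have scales: "scales {..<n} (B n) K (m n) s" if "0 < n" for n
  proof
    have "real (m n) \<le> real n powr c" by (simp add: m_def)
    then have "real (m n) ^ K \<le> (real n powr c) ^ K" by (intro power_mono) auto
    also have "\<dots> = real n"
      using that K by (simp add: powr_power c_def)
    finally have le: "m n ^ K \<le> n" by (metis of_nat_le_iff of_nat_power)
    have "1 \<le> real n powr c" using that c by (intro ge_one_powr_ge_zero) auto
    then show m_pos: "0 < m n" unfolding m_def by linarith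
    show "B n i \<subseteq> {..<n}" if "i < K" for i
    proof -
      have "m n ^ Suc i \<le> m n ^ K" using that m_pos by (intro power_increasing) auto
      then show ?thesis using le by (auto simp: B_def)
    qed
  qed (use K s in \<open>auto simp: B_def\<close>)

  have gap: "(1 + K * \<rho>) * (real k - 1 - \<epsilon>) \<le> (1 - 1 / s)\<^sup>2 * K"
  proof -
    have "(1 + K * \<rho>) * (real k - 1 - \<epsilon>) = (K - \<epsilon>) + \<epsilon> / 2 - \<epsilon>\<^sup>2 / (2 * K)"
      using K by (simp add: k \<rho>_def field_simps power2_eq_square)
    also have "\<dots> \<le> K - \<epsilon> / 2" using K by simp
    also have "\<dots> \<le> K - 2 * K / s"
      using s assms(2) by (simp add: field_simps)
    also have "\<dots> \<le> (1 - 1 / s)\<^sup>2 * K"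
      using s K by (simp add: field_simps power2_eq_square)
    finally show ?thesis .
  qed

  have "((\<lambda>n. s * exp a * exp (- (a / 2 * real n powr c))) \<longlongrightarrow> 0) sequentially"
  proof -
    have "((\<lambda>n. exp (- (a / 2 * real n powr c))) \<longlongrightarrow> 0) sequentially"
      using a c by real_asymp
    then show ?thesis by (rule tendsto_mult_right_zero)
  qed
  moreover have "0 < min (\<rho> / 2) (\<rho>\<^sup>2 / 8)" using \<rho> by simp
  ultimately have "\<forall>\<^sub>F n in sequentially. s * exp a * exp (- (a / 2 * real n powr c)) < min (\<rho> / 2) (\<rho>\<^sup>2 / 8)"
    by (rule order_tendstoD(2))
  then have small: "\<forall>\<^sub>F n in sequentially. 0 < n \<and> p n < \<rho> / 2 \<and> 8 * (N n * p n) \<le> \<rho>\<^sup>2"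
    using eventually_gt_at_top[of 0]
  proof eventually_elim
    case (elim n)
    have p_eq: "p n = s * exp (- (a * m n))" by (simp add: p_def a_def)
    \<comment> \<open>Rounding in \<open>m\<close> costs only the constant factor
      \<open>exp a\<close>.\<close>
    have "real n powr c - 1 \<le> m n" unfolding m_def by linarith
    then have "a * (real n powr c - 1) \<le> a * m n" using a by (intro mult_left_mono) auto
    then have "p n \<le> s * exp (a - a * real n powr c)"
      unfolding p_eq by (intro mult_left_mono) (auto simp: right_diff_distrib)
    moreover have "N n \<le> exp (a / 2 * real n powr c)"
    proof -
      have "ln (2::real) \<le> 1" using ln_le_minus_one[of "2::real"] by simp
      then have "a / 2 * real n powr c * ln 2 \<le> a / 2 * real n powr c * 1"
        using a by (intro mult_left_mono) auto
      then show ?thesis by (simp add: N_def powr_def)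
    qed
    ultimately have "N n * p n \<le> exp (a / 2 * real n powr c) * (s * exp (a - a * real n powr c))"
      by (intro mult_mono) (auto simp: p_def)
    also have "\<dots> = s * exp a * exp (- (a / 2 * real n powr c))"
      by (simp add: exp_add[symmetric] field_simps)
    finally have "N n * p n < min (\<rho> / 2) (\<rho>\<^sup>2 / 8)" using elim by linarith
    \<comment> \<open>Since \<open>N n\<close> is at least 1, the bound on \<open>N n * p n\<close>
      also bounds \<open>p n\<close>.\<close>
    moreover have "1 * p n \<le> N n * p n"
      using a by (intro mult_right_mono) (auto simp: N_def p_def intro!: ge_one_powr_ge_zero)
    ultimately show ?case using elim by auto
  qed

  define col where "col n = pmf_of_set ({..<n} \<rightarrow>\<^sub>E {..<s})" for n :: nat
  define F where "F n \<phi> = scales.inst (B n) K (m n) s (scales.light {..<n} (B n) K (m n) s \<phi>)" for n \<phi>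
  \<comment> \<open>For \<open>n = 0\<close> the construction would have \<open>m n = 0\<close>,
    which the locale excludes; the zero function is a harmless default.\<close>
  define D where "D n = (if n = 0 then return_pmf (\<lambda>_. 0) else map_pmf (F n) (col n))" for n
  have "k_XOS k {..<n} f" if "f \<in> set_pmf (D n)" for n f
  proof (cases "n = 0")
    case True
    have "k_XOS k {} (\<lambda>_::nat set. 0)"
      unfolding k_XOS_def using assms(1)
      by (intro conjI exI[of _ "\<lambda>_ _. 0"]) (auto simp: additive_on_def image_constant_conv)
    then show ?thesis using that True by (simp add: D_def)
  next
    case False
    interpret scales "{..<n}" "B n" K "m n" s using scales False by simp
    show ?thesis using that False k_XOS_inst by (auto simp: D_def F_def k)
  qed
  moreover have "\<forall>\<^sub>F n in sequentially.
       \<forall>R. approx_alg k (real k - 1 - \<epsilon>) {..<n} R \<longrightarrow>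
         (\<forall>\<delta>. 0 < \<delta> \<and> \<delta> < 1 \<longrightarrow>
            measure_pmf.prob (D n)
              {f. expected_calls R f \<ge> ennreal (\<delta> * 2 powr (a / 2 * real n powr c))} \<ge> 1 - \<delta>)"
    using small
  proof eventually_elim
    case (elim n)
    interpret scales "{..<n}" "B n" K "m n" s using scales elim by simp
    have F: "F n = (\<lambda>\<phi>. inst (light \<phi>))" by (simp add: F_def fun_eq_iff)
    show ?case
    proof (intro allI impI)
      fix R :: "nat oracle_alg measure" and \<delta> :: real
      assume R: "approx_alg k (real k - 1 - \<epsilon>) {..<n} R" and "0 < \<delta> \<and> \<delta> < 1"
      have "1 - \<delta> \<le> measure_pmf.prob (col n) {\<phi>. ennreal (\<delta> * N n) \<le> expected_calls R (F n \<phi>)}"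
      proof (rule prob_expected_calls_ge)
        show "finite (set_pmf (col n))"
          using finite_colourings by (simp add: col_def set_colourings)
        show "randomized_alg {..<n} R" using R by (simp add: approx_alg_def)
        show "measure_pmf.prob (col n) {\<phi>. F n \<phi> X \<noteq> mask X} \<le> p n" if "X \<subseteq> {..<n}" for X
          using prob_inst_neq_mask_le[OF that] by (simp add: col_def F p_def)
        show "\<rho> \<le> measure R {a\<in>space R. F n \<phi> (alg_output (F n \<phi>) a) \<noteq> mask (alg_output (F n \<phi>) a)}"
          if "\<phi> \<in> set_pmf (col n)" for \<phi>
          using approx_alg_found[OF R[unfolded k] _ gap[unfolded k]] that
          by (simp add: col_def set_colourings F)
      qed (use \<rho> elim \<open>0 < \<delta> \<and> \<delta> < 1\<close> in auto)
      then show "1 - \<delta> \<le> measure_pmf.prob (D n)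
          {f. expected_calls R f \<ge> ennreal (\<delta> * 2 powr (a / 2 * real n powr c))}"
        using elim by (simp add: D_def N_def)
    qed
  qed
  ultimately show ?thesis
    using a c by (intro exI[of _ c] conjI exI[of _ D] exI[of _ "a / 2"]) auto
qed

end
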